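(* For every positive integer $n$, the join-irreducible elements of the extra slow Tamari lattice $\operatorname{esTam}_n$ on fb-tableaux of size $n$ are in bijection with the set consisting of the following colored intervals: (1) $[i,j]_{\mathtt{red}}$ for $1\le i\le j\le n-1$; (2) $[i,j]_{\mathtt{green}}$ for $1\le i\le j\le n-1$; (3) $[i,j]_{\mathtt{blue}}$ for $1\le i<j\le n-1$.
   Context: Let $n$ be a positive integer. The board of size $n$ is the Ferrers diagram of shape $(n,n,n-1,n-2,\dots,3,2)$ (a single cell $(1,1)$ if $n=1$). Its cells are written $(i,j)$, where $i$ is the row, numbered from the top, and $j$ is the column label, the columns being labelled $n,n-1,\dots,1$ from left to right. So the cells are $(1,j)$ for $1\le j\le n$ and $(i,j)$ for $2\le i\le n$, $i-1\le j\le n$. The root is $(1,n)$ (top-left cell); the border cells are $(i,i-1)$ for $2\le i\le n$ (the rightmost cells of rows $2,\dots,n$). An fb-tableau of size $n$ is a filling in which each cell is either empty or nonempty such that the root and all border cells are nonempty, and every nonempty cell other than the root has a nonempty cell strictly to its left in the same row or strictly above it in the same column. In an fb-tableau, a nonempty cell different from the root is called a left-arrow if there is no nonempty cell strictly to its left in its row, an up-arrow if there is no nonempty cell strictly above it in its column, and a dot otherwise; the root is also a dot. (Each of rows $2,\dots,n$ has exactly one left-arrow, each of columns $1,\dots,n-1$ has exactly one up-arrow.) A cell is free in $T$ if it lies strictly below an up-arrow (same column) and strictly to the right of a left-arrow (same row); a free cell is either empty or contains a dot. $\operatorname{Row}(T)$ is the set of cells lying weakly to the right of a left-arrow or of the root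 in the same row; $\operatorname{Col}(T)$ is the set of cells lying weakly below an up-arrow or the root in the same column. For fb-tableaux $S,T$ of size $n$, write $S\lhd T$ if (1) $\operatorname{Col}(S)\subseteq\operatorname{Col}(T)$; (2) $\operatorname{Row}(T)\subseteq\operatorname{Row}(S)$; (3) for every cell $c$ that is free in both $S$ and $T$, if $c$ contains a dot in $S$ then $c$ contains a dot in $T$. The extra slow Tamari lattice $\operatorname{esTam}_n$ is the set of fb-tableaux of size $n$ ordered by $\lhd$; it is a finite lattice. An element is join-irreducible if it covers exactly one element. A colored interval $[i,j]_\sigma$ is just a formal symbol given by the pair $(i,j)$ and the color $\sigma$. *)

theory Defs
  imports Main
begin

type_synonym cell = "nat \<times> nat"

text \<open>
  A cell is a pair (row, column label). Rows are numbered from the top, whereas column labels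
  decrease from left to right; so ``left'' means a larger second component.
\<close>

definition left_of :: "cell \<Rightarrow> cell \<Rightarrow> bool" where
  "left_of c d \<longleftrightarrow> fst c = fst d \<and> snd d < snd c"

definition above :: "cell \<Rightarrow> cell \<Rightarrow> bool" where
  "above c d \<longleftrightarrow> snd c = snd d \<and> fst c < fst d"

definition board :: "nat \<Rightarrow> cell set" where
  "board n = {(1, j) | j. 1 \<le> j \<and> j \<le> n} \<union>
             {(i, j) | i j. 2 \<le> i \<and> i \<le> n \<and> i - 1 \<le> j \<and> j \<le> n}"

definition root :: "nat \<Rightarrow> cell" where
  "root n = (1, n)"

definition border :: "nat \<Rightarrow> cell set" where
  "border n = {(i, i - 1) | i. 2 \<le> i \<and> i \<le> n}"

text \<open>A filling of the board is represented by its set of nonempty cells.\<close>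

type_synonym filling = "cell set"

definition fb_tableau :: "nat \<Rightarrow> filling \<Rightarrow> bool" where
  "fb_tableau n T \<longleftrightarrow>
     T \<subseteq> board n \<and> root n \<in> T \<and> border n \<subseteq> T \<and>
     (\<forall>c\<in>T. c \<noteq> root n \<longrightarrow> (\<exists>d\<in>T. left_of d c \<or> above d c))"

definition left_arrow :: "nat \<Rightarrow> filling \<Rightarrow> cell \<Rightarrow> bool" where
  "left_arrow n T c \<longleftrightarrow> c \<in> T \<and> c \<noteq> root n \<and> \<not> (\<exists>d\<in>T. left_of d c)"

definition up_arrow :: "nat \<Rightarrow> filling \<Rightarrow> cell \<Rightarrow> bool" where
  "up_arrow n T c \<longleftrightarrow> c \<in> T \<and> c \<noteq> root n \<and> \<not> (\<exists>d\<in>T. above d c)"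

definition has_dot :: "nat \<Rightarrow> filling \<Rightarrow> cell \<Rightarrow> bool" where
  "has_dot n T c \<longleftrightarrow> c \<in> T \<and> \<not> left_arrow n T c \<and> \<not> up_arrow n T c"

definition free_cell :: "nat \<Rightarrow> filling \<Rightarrow> cell \<Rightarrow> bool" where
  "free_cell n T c \<longleftrightarrow>
     c \<in> board n \<and> (\<exists>u. up_arrow n T u \<and> above u c) \<and> (\<exists>l. left_arrow n T l \<and> left_of l c)"

definition Row :: "nat \<Rightarrow> filling \<Rightarrow> cell set" where
  "Row n T = {c \<in> board n. \<exists>d. (left_arrow n T d \<or> d = root n) \<and> (d = c \<or> left_of d c)}"

definition Col :: "nat \<Rightarrow> filling \<Rightarrow> cell set" where
  "Col n T = {c \<in> board n. \<exists>d. (up_arrow n T d \<or> d = root n) \<and> (d = c \<or> above d c)}"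

definition esTam :: "nat \<Rightarrow> filling set" where
  "esTam n = {T. fb_tableau n T}"

definition esTam_le :: "nat \<Rightarrow> filling \<Rightarrow> filling \<Rightarrow> bool" where
  "esTam_le n S T \<longleftrightarrow>
     Col n S \<subseteq> Col n T \<and>
     Row n T \<subseteq> Row n S \<and>
     (\<forall>c. free_cell n S c \<and> free_cell n T c \<and> has_dot n S c \<longrightarrow> has_dot n T c)"

definition covers :: "'a set \<Rightarrow> ('a \<Rightarrow> 'a \<Rightarrow> bool) \<Rightarrow> 'a \<Rightarrow> 'a \<Rightarrow> bool" where
  "covers L le y x \<longleftrightarrow>
     x \<in> L \<and> y \<in> L \<and> le x y \<and> x \<noteq> y \<and>
     \<not> (\<exists>z\<in>L. le x z \<and> le z y \<and> z \<noteq> x \<and> z \<noteq> y)"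

definition join_irreducibles :: "'a set \<Rightarrow> ('a \<Rightarrow> 'a \<Rightarrow> bool) \<Rightarrow> 'a set" where
  "join_irreducibles L le = {y \<in> L. \<exists>!x. covers L le y x}"

datatype color = Red | Green | Blue

datatype colored_interval = Colored_Interval nat nat color

definition colored_intervals :: "nat \<Rightarrow> colored_interval set" where
  "colored_intervals n =
     {Colored_Interval i j Red | i j. 1 \<le> i \<and> i \<le> j \<and> j \<le> n - 1} \<union>
     {Colored_Interval i j Green | i j. 1 \<le> i \<and> i \<le> j \<and> j \<le> n - 1} \<union>
     {Colored_Interval i j Blue | i j. 1 \<le> i \<and> i < j \<and> j \<le> n - 1}"

end

theory Submission
  imports Defs
begin

text \<open>
  In a finite poset an element is join-irreducible iff the elements strictly below it have a
  greatest one. A tableau \<open>T\<close> is determined by the row of the top cell of each column, the column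
  label of the leftmost cell of each row, and its free dots off the border. In these coordinates
  \<open>S \<lhd> T\<close> says that \<open>S\<close> has lower column tops, leftmost cells further to the left, and no dot, among
  the cells free in both, that \<open>T\<close> lacks. A tableau with two independent downward moves (deleting
  a dot, lowering a column top, extending a row to the last label \<open>n\<close>) cannot have a greatest
  element below it, because that element would be bounded by both moves and hence equal \<open>T\<close>.
  What remains is one family per colour, each a change of the minimum tableau near the cells
  \<open>(i, j)\<close> and \<open>(i + 1, j)\<close>.
\<close>

section \<open>Join-irreducibles of a finite poset\<close>

text \<open>A maximal element of the finite set of those \<open>z\<close> with
  \<open>le s z\<close>, \<open>le z y\<close> and \<open>z \<noteq> y\<close> is covered by
  \<open>y\<close>, since anything between it and \<open>y\<close> would lie in the same set. The
  set contains \<open>s\<close>.\<close>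

lemma maximal_strictly_below:
  assumes "finite L" "s \<in> L" "y \<in> L" "le s y" "s \<noteq> y"
    and refl: "\<And>x. x \<in> L \<Longrightarrow> le x x"
    and trans: "\<And>x y z. x \<in> L \<Longrightarrow> y \<in> L \<Longrightarrow> z \<in> L \<Longrightarrow> le x y \<Longrightarrow> le y z \<Longrightarrow> le x z"
    and antisym: "\<And>x y. x \<in> L \<Longrightarrow> y \<in> L \<Longrightarrow> le x y \<Longrightarrow> le y x \<Longrightarrow> x = y"
  obtains z where "covers L le y z" "le s z"
proof -
  let ?A = "{z \<in> L. le s z \<and> le z y \<and> z \<noteq> y}"
  let ?R = "\<lambda>a b. le a b \<and> a \<noteq> b"
  have "\<exists>m\<in>?A. \<forall>x\<in>?A. x \<noteq> m \<longrightarrow> \<not> ?R m x"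
  proof (rule Finite_Set.bex_max_element)
    show "finite ?A" using assms(1) by simp
    show "?A \<noteq> {}" using assms(2-5) refl[of s] by blast
    show "asymp_on ?A ?R" by (rule asymp_onI) (use antisym in blast)
    show "transp_on ?A ?R"
    proof (rule transp_onI)
      fix x y z assume "x \<in> ?A" "y \<in> ?A" "z \<in> ?A" "?R x y" "?R y z"
      then show "?R x z" using trans[of x y z] antisym[of x y] by blast
    qed
  qed
  then obtain m where m: "m \<in> ?A" "\<And>x. x \<in> ?A \<Longrightarrow> x \<noteq> m \<Longrightarrow> \<not> le m x" by blast
  have "covers L le y m"
    unfolding covers_def using m assms(2,3) trans[of s m] by blast
  then show thesis using that m(1) by blast
qed

text \<open>If \<open>p\<close> is the only element covered by \<open>y\<close>, each
  \<open>s\<close> strictly below \<open>y\<close> lies under some covered element, which must be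
  \<open>p\<close>. Conversely a greatest element \<open>p\<close> strictly below \<open>y\<close>
  is covered, and any other covered \<open>q\<close> would have \<open>p\<close> between itself and
  \<open>y\<close>. This removes covers from all later arguments.\<close>

lemma join_irreducible_iff_greatest_below:
  assumes "finite L"
    and refl: "\<And>x. x \<in> L \<Longrightarrow> le x x"
    and trans: "\<And>x y z. x \<in> L \<Longrightarrow> y \<in> L \<Longrightarrow> z \<in> L \<Longrightarrow> le x y \<Longrightarrow> le y z \<Longrightarrow> le x z"
    and antisym: "\<And>x y. x \<in> L \<Longrightarrow> y \<in> L \<Longrightarrow> le x y \<Longrightarrow> le y x \<Longrightarrow> x = y"
  shows "y \<in> join_irreducibles L le \<longleftrightarrow>
    y \<in> L \<and> (\<exists>p\<in>L. le p y \<and> p \<noteq> y \<and> (\<forall>s\<in>L. le s y \<and> s \<noteq> y \<longrightarrow> le s p))"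
proof
  assume "y \<in> join_irreducibles L le"
  then obtain p where y: "y \<in> L" and p: "covers L le y p"
    and unique: "\<And>q. covers L le y q \<Longrightarrow> q = p"
    by (auto simp: join_irreducibles_def)
  have "le s p" if s: "s \<in> L" "le s y" "s \<noteq> y" for s
  proof -
    obtain z where "covers L le y z" "le s z"
      using assms(1) s(1) y s(2,3) refl trans antisym by (rule maximal_strictly_below)
    then show ?thesis using unique by simp
  qed
  then show "y \<in> L \<and> (\<exists>p\<in>L. le p y \<and> p \<noteq> y \<and> (\<forall>s\<in>L. le s y \<and> s \<noteq> y \<longrightarrow> le s p))"
    using y p by (auto simp: covers_def)
next
  assume "y \<in> L \<and> (\<exists>p\<in>L. le p y \<and> p \<noteq> y \<and> (\<forall>s\<in>L. le s y \<and> s \<noteq> y \<longrightarrow> le s p))"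
  then obtain p where y: "y \<in> L" and p: "p \<in> L" "le p y" "p \<noteq> y"
    and greatest: "\<And>s. s \<in> L \<Longrightarrow> le s y \<Longrightarrow> s \<noteq> y \<Longrightarrow> le s p"
    by blast
  have "covers L le y p"
    unfolding covers_def using y p greatest antisym by blast
  moreover have "q = p" if "covers L le y q" for q
    using that p greatest unfolding covers_def by blast
  ultimately show "y \<in> join_irreducibles L le"
    using y by (auto simp: join_irreducibles_def)
qed


section \<open>Coordinates of an fb-tableau\<close>

definition topmost :: "filling \<Rightarrow> nat \<Rightarrow> nat" where
  "topmost T j = (LEAST i. (i, j) \<in> T)"

text \<open>Column labels decrease from left to right, so the leftmost nonempty cell is the one with
  the greatest label.\<close>

definition leftmost :: "filling \<Rightarrow> nat \<Rightarrow> nat" where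
  "leftmost T i = (GREATEST j. (i, j) \<in> T)"

text \<open>The border cells are left out: a free border cell contains a dot in every tableau.\<close>

definition dots :: "filling \<Rightarrow> cell set" where
  "dots T = {(i, j) \<in> T. i \<le> j \<and> topmost T j < i \<and> j < leftmost T i}"

lemma board_iff: "(i, j) \<in> board n \<longleftrightarrow> 1 \<le> i \<and> i \<le> n \<and> 1 \<le> j \<and> j \<le> n \<and> i \<le> j + 1"
  by (auto simp: board_def)

lemma border_iff: "(i, j) \<in> border n \<longleftrightarrow> 1 \<le> j \<and> j < n \<and> i = j + 1"
  by (auto simp: border_def)

lemma fb_tableau_cell:
  assumes "fb_tableau n T" "(i, j) \<in> T"
  shows "1 \<le> i" "i \<le> n" "1 \<le> j" "j \<le> n" "i \<le> j + 1"
  using assms board_iff unfolding fb_tableau_def by blast+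

lemma fb_tableau_root: "fb_tableau n T \<Longrightarrow> (1, n) \<in> T"
  by (simp add: fb_tableau_def root_def)

lemma fb_tableau_border: "fb_tableau n T \<Longrightarrow> 1 \<le> j \<Longrightarrow> j < n \<Longrightarrow> (j + 1, j) \<in> T"
  using border_iff[of "j + 1" j n] by (auto simp: fb_tableau_def)

lemma topmost_le: "(i, j) \<in> T \<Longrightarrow> topmost T j \<le> i"
  unfolding topmost_def by (rule Least_le)

lemma topmostI: "(i, j) \<in> T \<Longrightarrow> (\<And>k. (k, j) \<in> T \<Longrightarrow> i \<le> k) \<Longrightarrow> topmost T j = i"
  unfolding topmost_def by (rule Least_equality)

lemma leftmostI: "(i, j) \<in> T \<Longrightarrow> (\<And>k. (i, k) \<in> T \<Longrightarrow> k \<le> j) \<Longrightarrow> leftmost T i = j"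
  unfolding leftmost_def by (rule Greatest_equality)

lemma leftmost_ge: "fb_tableau n T \<Longrightarrow> (i, j) \<in> T \<Longrightarrow> j \<le> leftmost T i"
  unfolding leftmost_def by (rule Greatest_le_nat[where b = n]) (use fb_tableau_cell(4) in blast)+

text \<open>No column is empty: the root lies in column \<open>n\<close>, and each other column has
  a border cell.\<close>

lemma topmost_in:
  assumes "fb_tableau n T" "1 \<le> j" "j \<le> n"
  shows "(topmost T j, j) \<in> T"
proof -
  have "\<exists>i. (i, j) \<in> T"
    using fb_tableau_root[OF assms(1)] fb_tableau_border[OF assms(1), of j] assms(2,3)
    by (cases "j = n") auto
  then show ?thesis unfolding topmost_def by (rule LeastI_ex)
qed

lemma leftmost_in:
  assumes "fb_tableau n T" "1 \<le> i" "i \<le> n"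
  shows "(i, leftmost T i) \<in> T"
proof -
  have "\<exists>j. (i, j) \<in> T"
    using fb_tableau_root[OF assms(1)] fb_tableau_border[OF assms(1), of "i - 1"] assms(2,3)
    by (cases "i = 1") force+
  then show ?thesis unfolding leftmost_def
    by (rule GreatestI_ex_nat[where b = n]) (use fb_tableau_cell[OF assms(1)] in auto)
qed

lemma topmost_bounds:
  assumes "fb_tableau n T" "1 \<le> j" "j \<le> n"
  shows "1 \<le> topmost T j" "topmost T j \<le> n" "topmost T j \<le> j + 1"
  using fb_tableau_cell[OF assms(1) topmost_in[OF assms]] by auto

lemma leftmost_bounds:
  assumes "fb_tableau n T" "1 \<le> i" "i \<le> n"
  shows "1 \<le> leftmost T i" "leftmost T i \<le> n" "i \<le> leftmost T i + 1"
  using fb_tableau_cell[OF assms(1) leftmost_in[OF assms]] by auto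

lemma topmost_last: "fb_tableau n T \<Longrightarrow> 1 \<le> n \<Longrightarrow> topmost T n = 1"
  by (intro topmostI fb_tableau_root) (use fb_tableau_cell(1) in blast)+

lemma leftmost_first: "fb_tableau n T \<Longrightarrow> leftmost T 1 = n"
  by (intro leftmostI fb_tableau_root) (use fb_tableau_cell(4) in blast)+

lemma cell_above_iff:
  assumes "fb_tableau n T" "(i, j) \<in> T"
  shows "(\<exists>d\<in>T. above d (i, j)) \<longleftrightarrow> topmost T j < i"
proof
  assume "\<exists>d\<in>T. above d (i, j)"
  then show "topmost T j < i" by (auto simp: above_def dest!: topmost_le)
next
  assume "topmost T j < i"
  moreover have "(topmost T j, j) \<in> T"
    using topmost_in[OF assms(1)] fb_tableau_cell[OF assms] by simp
  ultimately show "\<exists>d\<in>T. above d (i, j)" by (force simp: above_def)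
qed

lemma cell_left_iff:
  assumes "fb_tableau n T" "(i, j) \<in> T"
  shows "(\<exists>d\<in>T. left_of d (i, j)) \<longleftrightarrow> j < leftmost T i"
proof
  assume "\<exists>d\<in>T. left_of d (i, j)"
  then show "j < leftmost T i" by (auto simp: left_of_def dest!: leftmost_ge[OF assms(1)])
next
  assume "j < leftmost T i"
  moreover have "(i, leftmost T i) \<in> T"
    using leftmost_in[OF assms(1)] fb_tableau_cell[OF assms] by simp
  ultimately show "\<exists>d\<in>T. left_of d (i, j)" by (force simp: left_of_def)
qed

lemma cell_dichotomy:
  assumes "fb_tableau n T" "(i, j) \<in> T" "(i, j) \<noteq> (1, n)"
  shows "topmost T j < i \<or> j < leftmost T i"
proof -
  obtain d where "d \<in> T" "left_of d (i, j) \<or> above d (i, j)"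
    using assms by (auto simp: fb_tableau_def root_def)
  then show ?thesis using cell_above_iff[OF assms(1,2)] cell_left_iff[OF assms(1,2)] by blast
qed

text \<open>The leftmost cell of a row has no support on its left, so below row 1 it must have a
  nonempty cell above it. This is the constraint that ties the two coordinate functions
  together.\<close>

lemma topmost_leftmost_less:
  assumes "fb_tableau n T" "2 \<le> i" "i \<le> n"
  shows "topmost T (leftmost T i) < i"
  using cell_dichotomy[OF assms(1) leftmost_in] assms by auto

lemma fb_tableauI:
  assumes "T \<subseteq> board n" "(1, n) \<in> T" "\<And>j. 1 \<le> j \<Longrightarrow> j < n \<Longrightarrow> (j + 1, j) \<in> T"
    and "\<And>i j. (i, j) \<in> T \<Longrightarrow> (i, j) \<noteq> (1, n) \<Longrightarrow>
      (\<exists>k>j. (i, k) \<in> T) \<or> (\<exists>k<i. (k, j) \<in> T)"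
  shows "fb_tableau n T"
  unfolding fb_tableau_def
proof (intro conjI ballI impI)
  show "border n \<subseteq> T" using assms(3) border_iff by auto
next
  fix c assume c: "c \<in> T" "c \<noteq> root n"
  obtain i j where ij: "c = (i, j)" by fastforce
  from assms(4)[of i j] c ij have "(\<exists>k>j. (i, k) \<in> T) \<or> (\<exists>k<i. (k, j) \<in> T)"
    by (simp add: root_def)
  then show "\<exists>d\<in>T. left_of d c \<or> above d c"
    unfolding ij left_of_def above_def by force
qed (use assms root_def in auto)

section \<open>Arrows, \<open>Row\<close>, \<open>Col\<close> and free cells in coordinates\<close>

lemma left_arrow_iff:
  assumes "fb_tableau n T"
  shows "left_arrow n T (i, j) \<longleftrightarrow> 2 \<le> i \<and> i \<le> n \<and> j = leftmost T i"
proof (cases "(i, j) \<in> T")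
  case True
  then show ?thesis
    using cell_left_iff[OF assms True] leftmost_ge[OF assms True] leftmost_first[OF assms]
      fb_tableau_cell[OF assms True]
    by (cases "i = 1") (auto simp: left_arrow_def root_def)
next
  case False
  then show ?thesis using leftmost_in[OF assms, of i] by (auto simp: left_arrow_def)
qed

lemma up_arrow_iff:
  assumes "fb_tableau n T"
  shows "up_arrow n T (i, j) \<longleftrightarrow> 1 \<le> j \<and> j < n \<and> i = topmost T j"
proof (cases "(i, j) \<in> T")
  case True
  then show ?thesis
    using cell_above_iff[OF assms True] topmost_le[OF True] topmost_last[OF assms]
      fb_tableau_cell[OF assms True]
    by (cases "j = n") (auto simp: up_arrow_def root_def)
next
  case False
  then show ?thesis using topmost_in[OF assms, of j] by (auto simp: up_arrow_def)
qed

lemma Row_iff: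
  assumes "fb_tableau n T"
  shows "(i, j) \<in> Row n T \<longleftrightarrow> (i, j) \<in> board n \<and> j \<le> leftmost T i"
proof -
  have "1 \<le> n" using fb_tableau_cell(2)[OF assms fb_tableau_root[OF assms]] .
  \<comment> \<open>Counting the root among the left-arrows supplies row 1, whose leftmost label is
    \<open>n\<close>, so that all rows obey one formula.\<close>
  then have "left_arrow n T (a, b) \<or> (a, b) = root n \<longleftrightarrow> 1 \<le> a \<and> a \<le> n \<and> b = leftmost T a"
    for a b
    using leftmost_first[OF assms]
    by (cases "a = 1") (auto simp: root_def left_arrow_iff[OF assms])
  then show ?thesis by (auto simp: Row_def board_iff left_of_def)
qed

lemma Col_iff:
  assumes "fb_tableau n T"
  shows "(i, j) \<in> Col n T \<longleftrightarrow> (i, j) \<in> board n \<and> topmost T j \<le> i"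
proof -
  have "1 \<le> n" using fb_tableau_cell(2)[OF assms fb_tableau_root[OF assms]] .
  then have "up_arrow n T (a, b) \<or> (a, b) = root n \<longleftrightarrow> 1 \<le> b \<and> b \<le> n \<and> a = topmost T b"
    for a b
    using topmost_last[OF assms]
    by (cases "b = n") (auto simp: root_def up_arrow_iff[OF assms])
  then show ?thesis by (auto simp: Col_def board_iff above_def)
qed

lemma free_cell_iff:
  assumes "fb_tableau n T"
  shows "free_cell n T (i, j) \<longleftrightarrow> (i, j) \<in> board n \<and> topmost T j < i \<and> j < leftmost T i"
proof (cases "(i, j) \<in> board n")
  case True
  then have b: "1 \<le> i" "i \<le> n" "1 \<le> j" "j \<le> n" by (auto simp: board_iff)
  show ?thesis
    using b topmost_bounds[OF assms b(3,4)] leftmost_bounds[OF assms b(1,2)] True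
    by (auto simp: free_cell_def above_def left_of_def up_arrow_iff[OF assms]
        left_arrow_iff[OF assms])
qed (simp add: free_cell_def)

lemma has_dot_free:
  assumes "fb_tableau n T" "free_cell n T (i, j)"
  shows "has_dot n T (i, j) \<longleftrightarrow> (i, j) \<in> T"
  using assms free_cell_iff[OF assms(1)] left_arrow_iff[OF assms(1)] up_arrow_iff[OF assms(1)]
  by (auto simp: has_dot_def)

section \<open>The order in coordinates\<close>

lemma dots_iff: "(i, j) \<in> dots T \<longleftrightarrow> (i, j) \<in> T \<and> i \<le> j \<and> topmost T j < i \<and> j < leftmost T i"
  by (simp add: dots_def)

text \<open>The last clause asks only \<open>j < leftmost T i\<close>, because the other half of
  freeness in \<open>T\<close> is inherited: \<open>topmost T j \<le> topmost S j < i\<close>.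
  Restricting to \<open>dots S\<close> loses only border cells, which are nonempty in every
  tableau.\<close>

lemma esTam_le_iff:
  assumes S: "fb_tableau n S" and T: "fb_tableau n T"
  shows "esTam_le n S T \<longleftrightarrow>
    (\<forall>j. 1 \<le> j \<and> j < n \<longrightarrow> topmost T j \<le> topmost S j) \<and>
    (\<forall>i. 2 \<le> i \<and> i \<le> n \<longrightarrow> leftmost T i \<le> leftmost S i) \<and>
    (\<forall>i j. (i, j) \<in> dots S \<and> j < leftmost T i \<longrightarrow> (i, j) \<in> T)"
    (is "_ \<longleftrightarrow> ?top \<and> ?left \<and> ?dots")
proof -
  have top: "Col n S \<subseteq> Col n T \<longleftrightarrow> ?top"
  proof
    assume sub: "Col n S \<subseteq> Col n T"
    show ?top
    proof (intro allI impI)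
      fix j assume j: "1 \<le> j \<and> j < n"
      then have "(topmost S j, j) \<in> Col n S"
        using topmost_bounds[OF S, of j] by (simp add: Col_iff[OF S] board_iff)
      then show "topmost T j \<le> topmost S j" using sub by (auto simp: Col_iff[OF T])
    qed
  next
    assume le: ?top
    have "topmost T j \<le> i" if "topmost S j \<le> i" "(i, j) \<in> board n" for i j
      using that le[rule_format, of j] topmost_last[OF T] by (cases "j = n") (auto simp: board_iff)
    then show "Col n S \<subseteq> Col n T" by (auto simp: Col_iff[OF S] Col_iff[OF T])
  qed
  have left: "Row n T \<subseteq> Row n S \<longleftrightarrow> ?left"
  proof
    assume sub: "Row n T \<subseteq> Row n S"
    show ?left
    proof (intro allI impI)
      fix i assume i: "2 \<le> i \<and> i \<le> n"
      then have "(i, leftmost T i) \<in> Row n T"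
        using leftmost_bounds[OF T, of i] by (simp add: Row_iff[OF T] board_iff)
      then show "leftmost T i \<le> leftmost S i" using sub by (auto simp: Row_iff[OF S])
    qed
  next
    assume le: ?left
    have "j \<le> leftmost S i" if "j \<le> leftmost T i" "(i, j) \<in> board n" for i j
      using that le[rule_format, of i] leftmost_first[OF S] by (cases "i = 1") (auto simp: board_iff)
    then show "Row n T \<subseteq> Row n S" by (auto simp: Row_iff[OF S] Row_iff[OF T])
  qed
  \<comment> \<open>This equivalence is stated relative to the coordinate inequalities, since
    freeness in \<open>T\<close> is deduced from the comparison of column tops.\<close>
  have dots: "(\<forall>c. free_cell n S c \<and> free_cell n T c \<and> has_dot n S c \<longrightarrow> has_dot n T c) \<longleftrightarrow> ?dots"
    (is "?free \<longleftrightarrow> _") if top: ?top and left: ?left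
  proof
    assume dot: ?free
    show ?dots
    proof (intro allI impI)
      fix i j assume ij: "(i, j) \<in> dots S \<and> j < leftmost T i"
      then have "(i, j) \<in> S" by (simp add: dots_iff)
      note b = fb_tableau_cell[OF S this] leftmost_bounds[OF T, of i]
      have "free_cell n S (i, j)" using ij b by (simp add: free_cell_iff[OF S] dots_iff board_iff)
      moreover have "free_cell n T (i, j)"
        using ij b top[rule_format, of j] by (simp add: free_cell_iff[OF T] dots_iff board_iff)
      ultimately show "(i, j) \<in> T"
        using dot[rule_format, of "(i, j)"] \<open>(i, j) \<in> S\<close> has_dot_free S T by blast
    qed
  next
    assume sub: ?dots
    show ?free
    proof (intro allI impI)
      fix c assume c: "free_cell n S c \<and> free_cell n T c \<and> has_dot n S c"
      obtain i j where ij: "c = (i, j)" by fastforce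
      have free: "free_cell n S (i, j)" "free_cell n T (i, j)" and "(i, j) \<in> S"
        using c has_dot_free[OF S] unfolding ij by auto
      note b = fb_tableau_cell[OF S \<open>(i, j) \<in> S\<close>] leftmost_bounds[OF T, of i]
      have "(i, j) \<in> T"
      proof (cases "i \<le> j")
        case True
        then show ?thesis using sub free \<open>(i, j) \<in> S\<close>
          by (auto simp: dots_iff free_cell_iff[OF S] free_cell_iff[OF T])
      next
        case False
        then have "i = j + 1" "j < n" using b free by (auto simp: free_cell_iff[OF T])
        then show ?thesis using fb_tableau_border[OF T] b by simp
      qed
      then show "has_dot n T c" using has_dot_free[OF T free(2)] ij by simp
    qed
  qed
  show ?thesis unfolding esTam_le_def top left using dots by blast
qed

lemma esTam_leD:
  assumes "fb_tableau n S" "fb_tableau n T" "esTam_le n S T"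
  shows "1 \<le> j \<Longrightarrow> j < n \<Longrightarrow> topmost T j \<le> topmost S j"
    and "2 \<le> i \<Longrightarrow> i \<le> n \<Longrightarrow> leftmost T i \<le> leftmost S i"
    and "(i, j) \<in> dots S \<Longrightarrow> j < leftmost T i \<Longrightarrow> (i, j) \<in> T"
  using assms(3) unfolding esTam_le_iff[OF assms(1,2)] by auto

lemma esTam_le_dots:
  assumes "fb_tableau n S" "fb_tableau n T" "esTam_le n S T" "(i, j) \<in> dots S" "j < leftmost T i"
  shows "(i, j) \<in> dots T"
proof -
  have ij: "(i, j) \<in> S" "i \<le> j" "topmost S j < i" using assms(4) by (auto simp: dots_iff)
  have b: "1 \<le> i" "i \<le> n" "1 \<le> j" "j \<le> n" using fb_tableau_cell[OF assms(1) ij(1)] by auto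
  have "j < n" using assms(5) leftmost_bounds[OF assms(2) b(1,2)] by linarith
  then have "topmost T j < i" using esTam_leD(1)[OF assms(1-3), of j] b ij by linarith
  then show ?thesis using esTam_leD(3)[OF assms(1-3)] assms(4,5) ij by (simp add: dots_iff)
qed

text \<open>Every nonempty cell is the top of its column, the leftmost of its row, a border cell, or
  a member of \<open>dots\<close>. Column \<open>n\<close> and row 1 need no hypothesis, since their
  coordinates are fixed by the root.\<close>

lemma fb_tableau_subset:
  assumes S: "fb_tableau n S" and T: "fb_tableau n T"
    and top: "\<And>j. 1 \<le> j \<Longrightarrow> j < n \<Longrightarrow> topmost S j = topmost T j"
    and left: "\<And>i. 2 \<le> i \<Longrightarrow> i \<le> n \<Longrightarrow> leftmost S i = leftmost T i"
    and dots: "dots S \<subseteq> dots T"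
  shows "S \<subseteq> T"
proof clarify
  fix i j assume ij: "(i, j) \<in> S"
  note b = fb_tableau_cell[OF S ij]
  have "topmost S j = topmost T j" using top[of j] topmost_last[OF S] topmost_last[OF T] b by (cases "j = n") auto
  moreover have "leftmost S i = leftmost T i"
    using left[of i] leftmost_first[OF S] leftmost_first[OF T] b by (cases "i = 1") auto
  ultimately have cases: "i = topmost T j \<or> j = leftmost T i \<or> i = j + 1 \<and> j < n"
    if "(i, j) \<notin> dots S"
    using that ij b topmost_le[OF ij] leftmost_ge[OF S ij] by (auto simp: dots_iff)
  show "(i, j) \<in> T"
  proof (cases "(i, j) \<in> dots S")
    case True
    then show ?thesis using dots dots_iff by blast
  next
    case False
    then show ?thesis
      using cases topmost_in[OF T, of j] leftmost_in[OF T, of i] fb_tableau_border[OF T, of j] b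
      by auto
  qed
qed

lemma fb_tableau_eqI:
  assumes "fb_tableau n S" "fb_tableau n T"
    and "\<And>j. 1 \<le> j \<Longrightarrow> j < n \<Longrightarrow> topmost S j = topmost T j"
    and "\<And>i. 2 \<le> i \<Longrightarrow> i \<le> n \<Longrightarrow> leftmost S i = leftmost T i"
    and "dots S = dots T"
  shows "S = T"
proof
  show "S \<subseteq> T" by (rule fb_tableau_subset[OF assms(1,2)]) (use assms(3-5) in blast)+
  show "T \<subseteq> S" by (rule fb_tableau_subset[OF assms(2,1)]) (use assms(3-5)[symmetric] in blast)+
qed

lemma esTam_le_refl: "fb_tableau n T \<Longrightarrow> esTam_le n T T"
  by (simp add: esTam_le_def)

lemma esTam_le_trans:
  assumes S: "fb_tableau n S" and T: "fb_tableau n T" and U: "fb_tableau n U"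
    and ST: "esTam_le n S T" and TU: "esTam_le n T U"
  shows "esTam_le n S U"
  unfolding esTam_le_iff[OF S U]
proof (intro conjI allI impI)
  show "topmost U j \<le> topmost S j" if "1 \<le> j \<and> j < n" for j
    using that esTam_leD(1)[OF S T ST, of j] esTam_leD(1)[OF T U TU, of j] by simp
  show left: "leftmost U i \<le> leftmost S i" if "2 \<le> i \<and> i \<le> n" for i
    using that esTam_leD(2)[OF S T ST, of i] esTam_leD(2)[OF T U TU, of i] by simp
  fix i j assume ij: "(i, j) \<in> dots S \<and> j < leftmost U i"
  then have "(i, j) \<in> S" "topmost S j < i" by (auto simp: dots_iff)
  \<comment> \<open>A dot lies strictly below its column top, hence not in row 1. This matters
    because the order compares leftmost labels only from row 2 on.\<close>
  moreover note b = fb_tableau_cell[OF S this(1)]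
  ultimately have "2 \<le> i" using topmost_bounds[OF S, of j] by linarith
  then have "j < leftmost T i" using ij b esTam_leD(2)[OF T U TU, of i] by linarith
  then show "(i, j) \<in> U"
    using esTam_le_dots[OF S T ST] esTam_leD(3)[OF T U TU] ij by blast
qed

text \<open>Once tops and leftmost labels agree, the same cells are free in both tableaux, so the
  two dot comparisons are opposite inclusions.\<close>

lemma esTam_le_antisym:
  assumes S: "fb_tableau n S" and T: "fb_tableau n T"
    and ST: "esTam_le n S T" and TS: "esTam_le n T S"
  shows "S = T"
proof (rule fb_tableau_eqI[OF S T])
  show "topmost S j = topmost T j" if "1 \<le> j" "j < n" for j
    using that esTam_leD(1)[OF S T ST] esTam_leD(1)[OF T S TS] by (simp add: le_antisym)
  have left: "leftmost S i = leftmost T i" if "1 \<le> i" "i \<le> n" for i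
    using that esTam_leD(2)[OF S T ST, of i] esTam_leD(2)[OF T S TS, of i]
      leftmost_first[OF S] leftmost_first[OF T] by (cases "i = 1") auto
  then show "leftmost S i = leftmost T i" if "2 \<le> i" "i \<le> n" for i using that by simp
  have "dots S \<subseteq> dots T"
  proof clarify
    fix i j assume ij: "(i, j) \<in> dots S"
    then have "leftmost S i = leftmost T i"
      using fb_tableau_cell[OF S] left by (meson dots_iff)
    then show "(i, j) \<in> dots T" using esTam_le_dots[OF S T ST ij] ij by (simp add: dots_iff)
  qed
  moreover have "dots T \<subseteq> dots S"
  proof clarify
    fix i j assume ij: "(i, j) \<in> dots T"
    then have "leftmost S i = leftmost T i"
      using fb_tableau_cell[OF T] left by (meson dots_iff)
    then show "(i, j) \<in> dots S" using esTam_le_dots[OF T S TS ij] ij by (simp add: dots_iff)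
  qed
  ultimately show "dots S = dots T" by (rule equalityI)
qed

lemma finite_esTam: "finite (esTam n)"
proof -
  have "board n \<subseteq> {1..n} \<times> {1..n}" by (auto simp: board_iff)
  then have "finite (board n)" by (rule finite_subset) simp
  moreover have "esTam n \<subseteq> Pow (board n)" by (auto simp: esTam_def fb_tableau_def)
  ultimately show ?thesis using finite_subset by blast
qed

lemma join_irreducible_esTam_iff:
  "T \<in> join_irreducibles (esTam n) (esTam_le n) \<longleftrightarrow>
    fb_tableau n T \<and> (\<exists>P. fb_tableau n P \<and> esTam_le n P T \<and> P \<noteq> T \<and>
      (\<forall>S. fb_tableau n S \<longrightarrow> esTam_le n S T \<longrightarrow> S \<noteq> T \<longrightarrow> esTam_le n S P))"
proof -
  have "T \<in> join_irreducibles (esTam n) (esTam_le n) \<longleftrightarrow>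
    T \<in> esTam n \<and> (\<exists>P\<in>esTam n. esTam_le n P T \<and> P \<noteq> T \<and>
      (\<forall>S\<in>esTam n. esTam_le n S T \<and> S \<noteq> T \<longrightarrow> esTam_le n S P))"
  proof (rule join_irreducible_iff_greatest_below[OF finite_esTam])
    fix R S T assume "R \<in> esTam n" "S \<in> esTam n" "T \<in> esTam n" "esTam_le n R S" "esTam_le n S T"
    then show "esTam_le n R T" unfolding esTam_def mem_Collect_eq by (rule esTam_le_trans)
  next
    fix S T assume "S \<in> esTam n" "T \<in> esTam n" "esTam_le n S T" "esTam_le n T S"
    then show "S = T" unfolding esTam_def mem_Collect_eq by (rule esTam_le_antisym)
  qed (simp add: esTam_def esTam_le_refl)
  then show ?thesis unfolding esTam_def by blast
qed

section \<open>Moving down from a tableau\<close>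

text \<open>The new cell is supported from above by the root, so no column top changes. The old
  left-arrow of row \<open>i\<close> may turn into a dot, but this does not disturb the order: it is
  not free in \<open>T\<close>.\<close>

lemma insert_last_column:
  assumes T: "fb_tableau n T" and i: "2 \<le> i" "i \<le> n"
  shows fb_tableau_insert_last: "fb_tableau n (insert (i, n) T)"
    and topmost_insert_last: "\<And>j. 1 \<le> j \<Longrightarrow> j \<le> n \<Longrightarrow> topmost (insert (i, n) T) j = topmost T j"
    and leftmost_insert_last: "\<And>k. 1 \<le> k \<Longrightarrow> k \<le> n \<Longrightarrow>
      leftmost (insert (i, n) T) k = (if k = i then n else leftmost T k)"
    and insert_last_le: "esTam_le n (insert (i, n) T) T"
proof -
  let ?S = "insert (i, n) T"
  show S: "fb_tableau n ?S"
  proof (rule fb_tableauI)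
    show "?S \<subseteq> board n" using T i by (auto simp: fb_tableau_def board_iff)
    show "(1, n) \<in> ?S" using fb_tableau_root[OF T] by simp
    show "(j + 1, j) \<in> ?S" if "1 \<le> j" "j < n" for j
      using fb_tableau_border[OF T that] by simp
    fix x y assume xy: "(x, y) \<in> ?S" "(x, y) \<noteq> (1, n)"
    show "(\<exists>k>y. (x, k) \<in> ?S) \<or> (\<exists>k<x. (k, y) \<in> ?S)"
    proof (cases "(x, y) = (i, n)")
      case True
      then show ?thesis using fb_tableau_root[OF T] i by (auto intro!: exI[of _ 1])
    next
      case False
      then have "(x, y) \<in> T" using xy by blast
      note b = fb_tableau_cell[OF T this]
      show ?thesis
        using cell_dichotomy[OF T \<open>(x, y) \<in> T\<close> xy(2)] topmost_in[OF T b(3,4)]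
          leftmost_in[OF T b(1,2)] by auto
    qed
  qed
  show top: "topmost ?S j = topmost T j" if "1 \<le> j" "j \<le> n" for j
  proof (rule topmostI)
    show "(topmost T j, j) \<in> ?S" using topmost_in[OF T that] by simp
    show "topmost T j \<le> k" if "(k, j) \<in> ?S" for k
      using that topmost_le[of k j T] topmost_last[OF T] i by auto
  qed
  show left: "leftmost ?S k = (if k = i then n else leftmost T k)" if "1 \<le> k" "k \<le> n" for k
  proof (rule leftmostI)
    show "(k, if k = i then n else leftmost T k) \<in> ?S" using leftmost_in[OF T that] by simp
    show "l \<le> (if k = i then n else leftmost T k)" if "(k, l) \<in> ?S" for l
      using that leftmost_ge[OF T, of k l] fb_tableau_cell(4)[OF S that] by auto
  qed
  show "esTam_le n ?S T" unfolding esTam_le_iff[OF S T]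
  proof (intro conjI allI impI)
    show "leftmost T k \<le> leftmost ?S k" if "2 \<le> k \<and> k \<le> n" for k
      using left[of k] leftmost_bounds(2)[OF T, of k] that by auto
    fix x y assume xy: "(x, y) \<in> dots ?S \<and> y < leftmost T x"
    then have "(x, y) \<in> ?S" by (simp add: dots_iff)
    then show "(x, y) \<in> T" using leftmost_bounds(2)[OF T, of i] xy i by auto
  qed (simp add: top)
qed

text \<open>A member of \<open>dots\<close> is neither a top, nor a leftmost cell, nor a border
  cell. The other cells keep their support, because support can always be taken from the top of the
  column or the leftmost cell of the row.\<close>

lemma remove_dot:
  assumes T: "fb_tableau n T" and ij: "(i, j) \<in> dots T"
  shows fb_tableau_remove_dot: "fb_tableau n (T - {(i, j)})"
    and topmost_remove_dot: "\<And>l. 1 \<le> l \<Longrightarrow> l \<le> n \<Longrightarrow> topmost (T - {(i, j)}) l = topmost T l"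
    and leftmost_remove_dot: "\<And>k. 1 \<le> k \<Longrightarrow> k \<le> n \<Longrightarrow> leftmost (T - {(i, j)}) k = leftmost T k"
    and remove_dot_le: "esTam_le n (T - {(i, j)}) T"
proof -
  let ?S = "T - {(i, j)}"
  have d: "(i, j) \<in> T" "i \<le> j" "topmost T j < i" "j < leftmost T i" using ij by (auto simp: dots_iff)
  have topS: "(topmost T l, l) \<in> ?S" if "1 \<le> l" "l \<le> n" for l
    using topmost_in[OF T that] d by auto
  have leftS: "(k, leftmost T k) \<in> ?S" if "1 \<le> k" "k \<le> n" for k
    using leftmost_in[OF T that] d by auto
  show S: "fb_tableau n ?S"
  proof (rule fb_tableauI)
    show "?S \<subseteq> board n" using T by (auto simp: fb_tableau_def)
    show "(1, n) \<in> ?S" using fb_tableau_root[OF T] leftmost_first[OF T] d by auto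
    show "(l + 1, l) \<in> ?S" if "1 \<le> l" "l < n" for l
      using fb_tableau_border[OF T that] d by auto
    fix x y assume xy: "(x, y) \<in> ?S" "(x, y) \<noteq> (1, n)"
    then have "(x, y) \<in> T" by simp
    note b = fb_tableau_cell[OF T this]
    show "(\<exists>k>y. (x, k) \<in> ?S) \<or> (\<exists>k<x. (k, y) \<in> ?S)"
      using cell_dichotomy[OF T \<open>(x, y) \<in> T\<close> xy(2)] topS[OF b(3,4)] leftS[OF b(1,2)] by blast
  qed
  show top: "topmost ?S l = topmost T l" if "1 \<le> l" "l \<le> n" for l
    by (rule topmostI[OF topS[OF that]]) (simp add: topmost_le)
  show left: "leftmost ?S k = leftmost T k" if "1 \<le> k" "k \<le> n" for k
    by (rule leftmostI[OF leftS[OF that]]) (simp add: leftmost_ge[OF T])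
  show "esTam_le n ?S T" unfolding esTam_le_iff[OF S T] by (auto simp: top left dots_iff)
qed

definition lower_top :: "nat \<Rightarrow> nat \<Rightarrow> filling \<Rightarrow> filling" where
  "lower_top a j T = insert (a, j) (T - {(i, j) | i. i < a})"

lemma mem_lower_top_iff:
  "(x, y) \<in> lower_top a j T \<longleftrightarrow> (x, y) = (a, j) \<or> (x, y) \<in> T \<and> (y = j \<longrightarrow> a \<le> x)"
  by (auto simp: lower_top_def)

text \<open>The condition \<open>j < leftmost T a\<close> gives the new top a support in its row,
  and \<open>left_neq\<close> says that no deleted cell is the leftmost of its row, so
  \<open>leftmost\<close> is unchanged. The inserted cell is a top and therefore creates no
  dot.\<close>

lemma lower_top:
  assumes T: "fb_tableau n T" and j: "1 \<le> j" "j < n"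
    and a: "topmost T j < a" "a \<le> j + 1" "j < leftmost T a"
    and left_neq: "\<And>i. 1 \<le> i \<Longrightarrow> i < a \<Longrightarrow> leftmost T i \<noteq> j"
  shows fb_tableau_lower_top: "fb_tableau n (lower_top a j T)"
    and topmost_lower_top: "\<And>l. 1 \<le> l \<Longrightarrow> l \<le> n \<Longrightarrow>
      topmost (lower_top a j T) l = (if l = j then a else topmost T l)"
    and leftmost_lower_top: "\<And>k. 1 \<le> k \<Longrightarrow> k \<le> n \<Longrightarrow>
      leftmost (lower_top a j T) k = leftmost T k"
    and lower_top_le: "esTam_le n (lower_top a j T) T"
proof -
  let ?S = "lower_top a j T"
  have "1 \<le> a" "a \<le> n" using a(1,2) j topmost_bounds[OF T, of j] by auto
  have topS: "(if l = j then a else topmost T l, l) \<in> ?S" if "1 \<le> l" "l \<le> n" for l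
    using topmost_in[OF T that] by (auto simp: mem_lower_top_iff)
  have leftS: "(k, leftmost T k) \<in> ?S" if "1 \<le> k" "k \<le> n" for k
    using leftmost_in[OF T that] left_neq[of k] that by (auto simp: mem_lower_top_iff not_le)
  show S: "fb_tableau n ?S"
  proof (rule fb_tableauI)
    show "?S \<subseteq> board n" using T a j \<open>1 \<le> a\<close> \<open>a \<le> n\<close>
      by (auto simp: fb_tableau_def lower_top_def board_iff)
    show "(1, n) \<in> ?S" using fb_tableau_root[OF T] j by (auto simp: mem_lower_top_iff)
    show "(l + 1, l) \<in> ?S" if "1 \<le> l" "l < n" for l
      using fb_tableau_border[OF T that] a by (auto simp: mem_lower_top_iff)
    fix x y assume xy: "(x, y) \<in> ?S" "(x, y) \<noteq> (1, n)"
    show "(\<exists>k>y. (x, k) \<in> ?S) \<or> (\<exists>k<x. (k, y) \<in> ?S)"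
    proof (cases "(x, y) = (a, j)")
      case True
      then show ?thesis using leftS[OF \<open>1 \<le> a\<close> \<open>a \<le> n\<close>] a by blast
    next
      case False
      then have "(x, y) \<in> T" "y = j \<longrightarrow> a < x" using xy by (auto simp: mem_lower_top_iff)
      note b = fb_tableau_cell[OF T this(1)]
      have "(if y = j then a else topmost T y) < x \<or> y < leftmost T x"
        using cell_dichotomy[OF T \<open>(x, y) \<in> T\<close> xy(2)] \<open>y = j \<longrightarrow> a < x\<close> by auto
      then show ?thesis using topS[OF b(3,4)] leftS[OF b(1,2)] by blast
    qed
  qed
  show top: "topmost ?S l = (if l = j then a else topmost T l)" if "1 \<le> l" "l \<le> n" for l
    by (rule topmostI[OF topS[OF that]]) (auto simp: topmost_le mem_lower_top_iff)
  show left: "leftmost ?S k = leftmost T k" if "1 \<le> k" "k \<le> n" for k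
    by (rule leftmostI[OF leftS[OF that]])
      (use leftmost_ge[OF T] a(3) in \<open>auto simp: mem_lower_top_iff\<close>)
  show "esTam_le n ?S T" unfolding esTam_le_iff[OF S T]
  proof (intro conjI allI impI)
    show "topmost T l \<le> topmost ?S l" if "1 \<le> l \<and> l < n" for l
      using that a top[of l] by auto
    fix x y assume xy: "(x, y) \<in> dots ?S \<and> y < leftmost T x"
    then show "(x, y) \<in> T" using top[of j] j by (auto simp: mem_lower_top_iff dots_iff)
  qed (simp add: left)
qed
lemma lower_top_neq:
  assumes "fb_tableau n T" "1 \<le> j" "j < n" "topmost T j < a"
  shows "lower_top a j T \<noteq> T"
proof
  assume "lower_top a j T = T"
  then have "(topmost T j, j) \<in> lower_top a j T" using topmost_in[of n T j] assms by simp
  then show False using assms(4) by (simp add: mem_lower_top_iff)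
qed


section \<open>The join-irreducible tableaux\<close>

definition base :: "nat \<Rightarrow> filling" where
  "base n = {(i, j). 1 \<le> i \<and> i \<le> n \<and> j = n \<or> 1 \<le> j \<and> j < n \<and> i = j + 1}"

definition red :: "nat \<Rightarrow> nat \<Rightarrow> nat \<Rightarrow> filling" where
  "red n a j = insert (a, j) (base n)"

text \<open>The cell \<open>(a + 1, j)\<close> is a dot below the raised top of column
  \<open>j\<close>. For \<open>a = j\<close> it would be a border cell and the filling would
  coincide with \<open>red n a j\<close>, which is why blue intervals are strict.\<close>

definition blue :: "nat \<Rightarrow> nat \<Rightarrow> nat \<Rightarrow> filling" where
  "blue n a j = {(a, j), (a + 1, j)} \<union> base n"

text \<open>Deleting \<open>(a + 1, n)\<close> makes \<open>(a + 1, j)\<close> the left-arrow of its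
  row, supported from above by the up-arrow \<open>(a, j)\<close>.\<close>

definition green :: "nat \<Rightarrow> nat \<Rightarrow> nat \<Rightarrow> filling" where
  "green n a j = {(a, j), (a + 1, j)} \<union> base n - {(a + 1, n)}"

lemma red_coordinates:
  assumes j: "1 \<le> j" "j < n" and a: "1 \<le> a" "a \<le> j + 1"
  shows fb_tableau_red: "fb_tableau n (red n a j)"
    and topmost_red: "\<And>k. 1 \<le> k \<Longrightarrow> k < n \<Longrightarrow> topmost (red n a j) k = (if k = j then a else k + 1)"
    and leftmost_red: "\<And>i. 1 \<le> i \<Longrightarrow> i \<le> n \<Longrightarrow> leftmost (red n a j) i = n"
    and dots_red: "dots (red n a j) = {}"
proof -
  let ?T = "red n a j"
  show T: "fb_tableau n ?T"
  proof (rule fb_tableauI)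
    fix x y assume xy: "(x, y) \<in> ?T" "(x, y) \<noteq> (1, n)"
    show "(\<exists>k>y. (x, k) \<in> ?T) \<or> (\<exists>k<x. (k, y) \<in> ?T)"
    proof (cases "y = n")
      case True
      then have "(1, y) \<in> ?T" "1 < x" using xy j by (auto simp: red_def base_def)
      then show ?thesis by blast
    next
      case False
      then have "(x, n) \<in> ?T" "y < n" using xy j a by (auto simp: red_def base_def)
      then show ?thesis by blast
    qed
  qed (use j a in \<open>auto simp: red_def base_def board_iff\<close>)
  show top: "topmost ?T k = (if k = j then a else k + 1)" if "1 \<le> k" "k < n" for k
    by (rule topmostI) (use that j a in \<open>auto simp: red_def base_def\<close>)
  show left: "leftmost ?T i = n" if "1 \<le> i" "i \<le> n" for i
    by (rule leftmostI) (use that j a in \<open>auto simp: red_def base_def\<close>)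
  have False if xy: "(x, y) \<in> dots ?T" for x y
  proof -
    have "(x, y) \<in> ?T" "x \<le> y" "topmost ?T y < x" "y < leftmost ?T x"
      using xy by (auto simp: dots_iff)
    moreover from fb_tableau_cell[OF T this(1)] have "leftmost ?T x = n" using left by simp
    ultimately show False using top[OF j] by (auto simp: red_def base_def)
  qed
  then show "dots ?T = {}" by auto
qed

lemma blue_coordinates:
  assumes j: "1 \<le> a" "a < j" "j < n"
  shows fb_tableau_blue: "fb_tableau n (blue n a j)"
    and topmost_blue: "\<And>k. 1 \<le> k \<Longrightarrow> k < n \<Longrightarrow> topmost (blue n a j) k = (if k = j then a else k + 1)"
    and leftmost_blue: "\<And>i. 1 \<le> i \<Longrightarrow> i \<le> n \<Longrightarrow> leftmost (blue n a j) i = n"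
    and dots_blue: "dots (blue n a j) = {(a + 1, j)}"
proof -
  let ?T = "blue n a j"
  show T: "fb_tableau n ?T"
  proof (rule fb_tableauI)
    fix x y assume xy: "(x, y) \<in> ?T" "(x, y) \<noteq> (1, n)"
    show "(\<exists>k>y. (x, k) \<in> ?T) \<or> (\<exists>k<x. (k, y) \<in> ?T)"
    proof (cases "y = n")
      case True
      then have "(1, y) \<in> ?T" "1 < x" using xy j by (auto simp: blue_def base_def)
      then show ?thesis by blast
    next
      case False
      then have "(x, n) \<in> ?T" "y < n" using xy j by (auto simp: blue_def base_def)
      then show ?thesis by blast
    qed
  qed (use j in \<open>auto simp: blue_def base_def board_iff\<close>)
  show top: "topmost ?T k = (if k = j then a else k + 1)" if "1 \<le> k" "k < n" for k
    by (rule topmostI) (use that j in \<open>auto simp: blue_def base_def\<close>)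
  show left: "leftmost ?T i = n" if "1 \<le> i" "i \<le> n" for i
    by (rule leftmostI) (use that j in \<open>auto simp: blue_def base_def\<close>)
  have "(x, y) \<in> {(a + 1, j)}" if xy: "(x, y) \<in> dots ?T" for x y
  proof -
    have "(x, y) \<in> ?T" "x \<le> y" "topmost ?T y < x" "y < leftmost ?T x"
      using xy by (auto simp: dots_iff)
    moreover from fb_tableau_cell[OF T this(1)] have "leftmost ?T x = n" using left by simp
    ultimately have "y = j" "x = a \<or> x = a + 1" "topmost ?T j < x"
      by (auto simp: blue_def base_def)
    then show ?thesis using top[of j] j by auto
  qed
  moreover have "(a + 1, j) \<in> dots ?T"
    using top[of j] left[of "a + 1"] j unfolding dots_iff by (simp add: blue_def)
  ultimately show "dots ?T = {(a + 1, j)}" by (intro equalityI subrelI) blast+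
qed

lemma green_coordinates:
  assumes j: "1 \<le> a" "a \<le> j" "j < n"
  shows fb_tableau_green: "fb_tableau n (green n a j)"
    and topmost_green: "\<And>k. 1 \<le> k \<Longrightarrow> k < n \<Longrightarrow> topmost (green n a j) k = (if k = j then a else k + 1)"
    and leftmost_green: "\<And>i. 1 \<le> i \<Longrightarrow> i \<le> n \<Longrightarrow>
      leftmost (green n a j) i = (if i = a + 1 then j else n)"
    and dots_green: "dots (green n a j) = {}"
proof -
  let ?T = "green n a j"
  show T: "fb_tableau n ?T"
  proof (rule fb_tableauI)
    fix x y assume xy: "(x, y) \<in> ?T" "(x, y) \<noteq> (1, n)"
    \<comment> \<open>Row \<open>a + 1\<close> no longer reaches column \<open>n\<close>, so its
      cells need other supports: \<open>(a + 1, j)\<close> uses \<open>(a, j)\<close> above it, and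
      a border cell distinct from it uses \<open>(a + 1, j)\<close> on its left.\<close>
    consider "y = n" | "y < n" "x \<noteq> a + 1" | "x = a + 1" "y = j" | "x = a + 1" "y = a" "a < j"
      using xy j by (fastforce simp: green_def base_def)
    then show "(\<exists>k>y. (x, k) \<in> ?T) \<or> (\<exists>k<x. (k, y) \<in> ?T)"
    proof cases
      case 1
      then have "(1, y) \<in> ?T" "1 < x" using xy j by (auto simp: green_def base_def)
      then show ?thesis by blast
    next
      case 2
      then have "(x, n) \<in> ?T" using xy j by (auto simp: green_def base_def)
      then show ?thesis using 2 by blast
    next
      case 3
      then have "(a, y) \<in> ?T" "a < x" using j by (auto simp: green_def base_def)
      then show ?thesis by blast
    next
      case 4
      then have "(x, j) \<in> ?T" "y < j" using j by (auto simp: green_def base_def)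
      then show ?thesis by blast
    qed
  qed (use j in \<open>auto simp: green_def base_def board_iff\<close>)
  show top: "topmost ?T k = (if k = j then a else k + 1)" if "1 \<le> k" "k < n" for k
    by (rule topmostI) (use that j in \<open>auto simp: green_def base_def\<close>)
  show left: "leftmost ?T i = (if i = a + 1 then j else n)" if "1 \<le> i" "i \<le> n" for i
    by (rule leftmostI) (use that j in \<open>auto simp: green_def base_def split: if_splits\<close>)
  have False if xy: "(x, y) \<in> dots ?T" for x y
  proof -
    have "(x, y) \<in> ?T" "x \<le> y" "topmost ?T y < x" "y < leftmost ?T x"
      using xy by (auto simp: dots_iff)
    moreover from fb_tableau_cell[OF T this(1)]
    have "leftmost ?T x = (if x = a + 1 then j else n)" using left by simp
    ultimately show False using top[of j] j by (auto simp: green_def base_def split: if_splits)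
  qed
  then show "dots ?T = {}" by auto
qed

section \<open>Members of the families are join-irreducible\<close>

lemma red_join_irreducible:
  assumes j: "1 \<le> a" "a \<le> j" "j < n"
  shows "red n a j \<in> join_irreducibles (esTam n) (esTam_le n)"
proof -
  \<comment> \<open>The greatest element strictly below has the top of column \<open>j\<close> one
    row further down. All other coordinates of \<open>?T\<close> are already extreme, so a tableau
    below it can differ only in that top.\<close>
  let ?T = "red n a j" and ?P = "red n (a + 1) j"
  have T: "fb_tableau n ?T" and P: "fb_tableau n ?P" using j by (auto intro!: fb_tableau_red)
  have topT: "topmost ?T k = (if k = j then a else k + 1)" if "1 \<le> k" "k < n" for k
    by (rule topmost_red) (use j that in auto)
  have topP: "topmost ?P k = (if k = j then a + 1 else k + 1)" if "1 \<le> k" "k < n" for k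
    by (rule topmost_red) (use j that in auto)
  have leftT: "leftmost ?T i = n" if "1 \<le> i" "i \<le> n" for i
    by (rule leftmost_red) (use j that in auto)
  have leftP: "leftmost ?P i = n" if "1 \<le> i" "i \<le> n" for i
    by (rule leftmost_red) (use j that in auto)
  have dotsT: "dots ?T = {}" by (rule dots_red) (use j in auto)
  have dotsP: "dots ?P = {}" by (rule dots_red) (use j in auto)
  have "esTam_le n ?P ?T"
    unfolding esTam_le_iff[OF P T] using topT topP leftT leftP dotsP by auto
  moreover have "?P \<noteq> ?T" using topT[of j] topP[of j] j by force
  moreover have "esTam_le n S ?P" if S: "fb_tableau n S" and le: "esTam_le n S ?T" and neq: "S \<noteq> ?T" for S
  proof -
    have left: "leftmost S i = n" if "2 \<le> i" "i \<le> n" for i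
      using esTam_leD(2)[OF S T le that] leftT[of i] leftmost_bounds(2)[OF S, of i] that by simp
    have top: "topmost S k = k + 1" if "1 \<le> k" "k < n" "k \<noteq> j" for k
      using esTam_leD(1)[OF S T le that(1,2)] topT[OF that(1,2)] topmost_bounds(3)[OF S, of k] that
      by simp
    have dots: "dots S \<subseteq> {}"
    proof (rule subrelI)
      fix x y assume xy: "(x, y) \<in> dots S"
      then have mem: "(x, y) \<in> S" and "y < leftmost S x" by (auto simp: dots_iff)
      note b = fb_tableau_cell[OF S mem]
      have "y < leftmost ?T x"
        using \<open>y < leftmost S x\<close> leftmost_bounds(2)[OF S b(1,2)] leftT[OF b(1,2)] by simp
      then show "(x, y) \<in> {}" using esTam_le_dots[OF S T le xy] dotsT by simp
    qed
    have "topmost S j \<noteq> a"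
    proof
      assume "topmost S j = a"
      then have "S = ?T"
        using top topT left leftT dots dotsT by (intro fb_tableau_eqI[OF S T]) auto
      then show False using neq by simp
    qed
    then have "a + 1 \<le> topmost S j" using esTam_leD(1)[OF S T le, of j] topT[of j] j by simp
    then show ?thesis
      unfolding esTam_le_iff[OF S P] using top topP left leftP dots by auto
  qed
  ultimately show ?thesis unfolding join_irreducible_esTam_iff using T P by blast
qed

lemma blue_join_irreducible:
  assumes j: "1 \<le> a" "a < j" "j < n"
  shows "blue n a j \<in> join_irreducibles (esTam n) (esTam_le n)"
proof -
  \<comment> \<open>The greatest element strictly below is obtained by deleting the dot.\<close>
  let ?T = "blue n a j" and ?P = "red n a j"
  have T: "fb_tableau n ?T" and P: "fb_tableau n ?P"
    using j by (auto intro!: fb_tableau_red fb_tableau_blue)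
  have topT: "topmost ?T k = (if k = j then a else k + 1)" if "1 \<le> k" "k < n" for k
    by (rule topmost_blue) (use j that in auto)
  have topP: "topmost ?P k = (if k = j then a else k + 1)" if "1 \<le> k" "k < n" for k
    by (rule topmost_red) (use j that in auto)
  have leftT: "leftmost ?T i = n" if "1 \<le> i" "i \<le> n" for i
    by (rule leftmost_blue) (use j that in auto)
  have leftP: "leftmost ?P i = n" if "1 \<le> i" "i \<le> n" for i
    by (rule leftmost_red) (use j that in auto)
  have dotsT: "dots ?T = {(a + 1, j)}" by (rule dots_blue[OF j])
  have dotsP: "dots ?P = {}" by (rule dots_red) (use j in auto)
  have "esTam_le n ?P ?T"
    unfolding esTam_le_iff[OF P T] using topT topP leftT leftP dotsP by auto
  moreover have "?P \<noteq> ?T" using dotsT dotsP by force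
  moreover have "esTam_le n S ?P" if S: "fb_tableau n S" and le: "esTam_le n S ?T" and neq: "S \<noteq> ?T" for S
  proof -
    have left: "leftmost S i = n" if "2 \<le> i" "i \<le> n" for i
      using esTam_leD(2)[OF S T le that] leftT[of i] leftmost_bounds(2)[OF S, of i] that by simp
    have top: "topmost S k = k + 1" if "1 \<le> k" "k < n" "k \<noteq> j" for k
      using esTam_leD(1)[OF S T le that(1,2)] topT[OF that(1,2)] topmost_bounds(3)[OF S, of k] that
      by simp
    have topj: "a \<le> topmost S j" using esTam_leD(1)[OF S T le, of j] topT[of j] j by simp
    have sub: "dots S \<subseteq> {(a + 1, j)}"
    proof (rule subrelI)
      fix x y assume xy: "(x, y) \<in> dots S"
      then have mem: "(x, y) \<in> S" and "y < leftmost S x" by (auto simp: dots_iff)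
      note b = fb_tableau_cell[OF S mem]
      have "y < leftmost ?T x"
        using \<open>y < leftmost S x\<close> leftmost_bounds(2)[OF S b(1,2)] leftT[OF b(1,2)] by simp
      then show "(x, y) \<in> {(a + 1, j)}" using esTam_le_dots[OF S T le xy] dotsT by simp
    qed
    have "(a + 1, j) \<notin> dots S"
    proof
      assume dot: "(a + 1, j) \<in> dots S"
      \<comment> \<open>A dot in row \<open>a + 1\<close> forces the top of column \<open>j\<close>
        into row \<open>a\<close> or higher, so a tableau below \<open>?T\<close> that keeps the dot
        equals \<open>?T\<close>.\<close>
      then have "topmost S j = a" using topj by (simp add: dots_iff)
      moreover have "dots S = {(a + 1, j)}" using sub dot by blast
      ultimately have "S = ?T"
        using top topT left leftT dotsT by (intro fb_tableau_eqI[OF S T]) auto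
      then show False using neq by simp
    qed
    then have dots: "dots S = {}" using sub by blast
    show ?thesis
      unfolding esTam_le_iff[OF S P] using top topj topP left leftP dots by auto
  qed
  ultimately show ?thesis unfolding join_irreducible_esTam_iff using T P by blast
qed

lemma green_join_irreducible:
  assumes j: "1 \<le> a" "a \<le> j" "j < n"
  shows "green n a j \<in> join_irreducibles (esTam n) (esTam_le n)"
proof -
  \<comment> \<open>As a set \<open>?P\<close> is \<open>blue n a j\<close>, which for
    \<open>a = j\<close> is \<open>red n a j\<close>.\<close>
  let ?T = "green n a j" let ?P = "insert (a + 1, n) ?T"
  have a: "2 \<le> a + 1" "a + 1 \<le> n" using j by auto
  note T = fb_tableau_green[OF j] and topT = topmost_green[OF j] and leftT = leftmost_green[OF j]
    and dotsT = dots_green[OF j]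
  note P = fb_tableau_insert_last[OF T a]
  have topP: "topmost ?P k = topmost ?T k" if "1 \<le> k" "k < n" for k
    using topmost_insert_last[OF T a] that by simp
  have leftP: "leftmost ?P i = n" if "1 \<le> i" "i \<le> n" for i
    using leftmost_insert_last[OF T a that] leftT[OF that] by simp
  have "esTam_le n ?P ?T" by (rule insert_last_le[OF T a])
  moreover have "?P \<noteq> ?T" by (auto simp: green_def)
  moreover have "esTam_le n S ?P" if S: "fb_tableau n S" and le: "esTam_le n S ?T" and neq: "S \<noteq> ?T" for S
  proof -
    have left: "leftmost S i = n" if "2 \<le> i" "i \<le> n" "i \<noteq> a + 1" for i
      using esTam_leD(2)[OF S T le that(1,2)] leftT[of i] leftmost_bounds(2)[OF S, of i] that by simp
    have top: "topmost S k = k + 1" if "1 \<le> k" "k < n" "k \<noteq> j" for k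
      using esTam_leD(1)[OF S T le that(1,2)] topT[OF that(1,2)] topmost_bounds(3)[OF S, of k] that
      by simp
    have topj: "a \<le> topmost S j" using esTam_leD(1)[OF S T le, of j] topT[of j] j by simp
    let ?m = "leftmost S (a + 1)"
    have m: "j \<le> ?m" "?m \<le> n" "topmost S ?m < a + 1"
      using esTam_leD(2)[OF S T le a] leftT[of "a + 1"] leftmost_bounds(2)[OF S, of "a + 1"]
        topmost_leftmost_less[OF S a] a by simp_all
    have new_dot: "x = a + 1 \<and> y = j" if xy: "(x, y) \<in> dots S" for x y
    proof (rule ccontr)
      assume neq: "\<not> (x = a + 1 \<and> y = j)"
      have mem: "(x, y) \<in> S" "x \<le> y" "topmost S y < x" "y < leftmost S x"
        using xy by (auto simp: dots_iff)
      note b = fb_tableau_cell[OF S mem(1)]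
      have "y < n" using mem(4) leftmost_bounds(2)[OF S b(1,2)] by simp
      \<comment> \<open>In any other column the top is the border cell, so no cell with
        \<open>x \<le> y\<close> lies strictly below it.\<close>
      then have "y = j" using top[of y] mem b by force
      then have "y < leftmost ?T x" using neq leftT[OF b(1,2)] \<open>y < n\<close> by simp
      then show False using esTam_le_dots[OF S T le xy] dotsT by simp
    qed
    have "?m \<noteq> j"
    proof
      assume mj: "?m = j"
      then have "topmost S j = a" using m(3) topj by simp
      moreover have "dots S = dots ?T"
        using new_dot mj unfolding dotsT by (fastforce simp: dots_iff)
      ultimately have "S = ?T"
        using top topT left leftT mj by (intro fb_tableau_eqI[OF S T]) auto
      then show False using neq by simp
    qed
    \<comment> \<open>There is no intermediate position for the left-arrow of row
      \<open>a + 1\<close>: it needs a cell above it, but a column strictly between labels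
      \<open>j\<close> and \<open>n\<close> has its top at row \<open>?m + 1\<close>, which is too
      low.\<close>
    have "?m = n"
    proof (rule ccontr)
      assume "?m \<noteq> n"
      then have "topmost S ?m = ?m + 1" using top[of ?m] m j \<open>?m \<noteq> j\<close> by simp
      then show False using m j by simp
    qed
    then have "leftmost S i = n" if "2 \<le> i" "i \<le> n" for i
      using left that by (cases "i = a + 1") auto
    moreover have "(a + 1, j) \<in> ?P" using j by (simp add: green_def)
    ultimately show ?thesis
      unfolding esTam_le_iff[OF S P] using esTam_leD(1)[OF S T le] topP leftP new_dot by auto
  qed
  ultimately show ?thesis unfolding join_irreducible_esTam_iff using T P by blast
qed

section \<open>Every join-irreducible belongs to a family\<close>

lemma join_irreducible_greenI:
  assumes T: "T \<in> join_irreducibles (esTam n) (esTam_le n)"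
    and i: "2 \<le> i" "i \<le> n" "leftmost T i < n"
  shows "T = green n (i - 1) (leftmost T i)"
proof -
  let ?m = "leftmost T i"
  obtain P where fbT: "fb_tableau n T" and P: "fb_tableau n P" and PT: "esTam_le n P T" "P \<noteq> T"
    and below: "\<And>S. fb_tableau n S \<Longrightarrow> esTam_le n S T \<Longrightarrow> S \<noteq> T \<Longrightarrow> esTam_le n S P"
    using T unfolding join_irreducible_esTam_iff by blast
  let ?S = "insert (i, n) T"
  note S = fb_tableau_insert_last[OF fbT i(1,2)]
  note topS = topmost_insert_last[OF fbT i(1,2)] and leftS = leftmost_insert_last[OF fbT i(1,2)]
  have "(i, n) \<notin> T" using leftmost_ge[OF fbT, of i n] i by auto
  then have SP: "esTam_le n ?S P" using below[OF S insert_last_le[OF fbT i(1,2)]] by blast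
  \<comment> \<open>The extension \<open>?S\<close> of row \<open>i\<close> lies below
    \<open>P\<close> and agrees with \<open>T\<close> in every other coordinate. If \<open>P\<close>
    did not extend row \<open>i\<close> as well, \<open>T\<close> would lie below \<open>P\<close>,
    and antisymmetry would give \<open>P = T\<close>.\<close>
  have "?m < leftmost P i"
  proof (rule ccontr)
    assume ge: "\<not> ?m < leftmost P i"
    have "esTam_le n T P" unfolding esTam_le_iff[OF fbT P]
    proof (intro conjI allI impI)
      show "topmost P k \<le> topmost T k" if "1 \<le> k \<and> k < n" for k
        using esTam_leD(1)[OF S P SP, of k] topS[of k] that by simp
      show "leftmost P k \<le> leftmost T k" if "2 \<le> k \<and> k \<le> n" for k
        using esTam_leD(2)[OF S P SP, of k] leftS[of k] that ge by (cases "k = i") auto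
      fix x y assume xy: "(x, y) \<in> dots T \<and> y < leftmost P x"
      then have mem: "(x, y) \<in> T" by (simp add: dots_iff)
      note b = fb_tableau_cell[OF fbT mem]
      have "leftmost T x \<le> leftmost ?S x"
        using leftS[OF b(1,2)] leftmost_bounds(2)[OF fbT b(1,2)] by (cases "x = i") auto
      then have "(x, y) \<in> dots ?S" using xy topS[OF b(3,4)] by (simp add: dots_iff)
      then show "(x, y) \<in> P" using esTam_leD(3)[OF S P SP] xy by simp
    qed
    then show False using esTam_le_antisym[OF P fbT PT(1)] PT(2) by simp
  qed
  \<comment> \<open>Since everything strictly below \<open>T\<close> lies below \<open>P\<close>,
    each such tableau extends row \<open>i\<close>. Hence every downward move that leaves row
    \<open>i\<close> alone is impossible, which fixes all other coordinates of
    \<open>T\<close>.\<close>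
  then have key: "?m < leftmost S i" if "fb_tableau n S" "esTam_le n S T" "S \<noteq> T" for S
    using esTam_leD(2)[OF that(1) P below[OF that] i(1,2)] by simp
  have left: "leftmost T k = n" if k: "2 \<le> k" "k \<le> n" "k \<noteq> i" for k
  proof (rule ccontr)
    assume "leftmost T k \<noteq> n"
    then have "(k, n) \<notin> T"
      using leftmost_ge[OF fbT, of k n] leftmost_bounds(2)[OF fbT, of k] k by auto
    then have "?m < leftmost (insert (k, n) T) i"
      using key[OF fb_tableau_insert_last[OF fbT k(1,2)] insert_last_le[OF fbT k(1,2)]] by blast
    then show False using leftmost_insert_last[OF fbT k(1,2), of i] i k by simp
  qed
  have left': "leftmost T k = n" if "1 \<le> k" "k \<le> n" "k \<noteq> i" for k
    using left[of k] leftmost_first[OF fbT] that by (cases "k = 1") auto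
  have dots: "dots T = {}"
  proof (rule ccontr)
    assume "dots T \<noteq> {}"
    then obtain x y where xy: "(x, y) \<in> dots T" by auto
    then have "(x, y) \<in> T" by (simp add: dots_iff)
    then have "?m < leftmost (T - {(x, y)}) i"
      using key[OF fb_tableau_remove_dot[OF fbT xy] remove_dot_le[OF fbT xy]] by blast
    then show False using leftmost_remove_dot[OF fbT xy, of i] i by simp
  qed
  have no_lower_top: False
    if "1 \<le> k" "k < n" "topmost T k < a" "a \<le> k + 1" "k < leftmost T a"
      "\<And>x. 1 \<le> x \<Longrightarrow> x < a \<Longrightarrow> leftmost T x \<noteq> k" for k a
    using key[OF fb_tableau_lower_top[OF fbT that] lower_top_le[OF fbT that]
        lower_top_neq[OF fbT that(1-3)]] leftmost_lower_top[OF fbT that, of i] i by simp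
  note m = leftmost_bounds[OF fbT, of i]
  have top: "topmost T k = k + 1" if k: "1 \<le> k" "k < n" "k \<noteq> ?m" for k
  proof (rule ccontr)
    assume "topmost T k \<noteq> k + 1"
    then have "topmost T k < k + 1" using topmost_bounds(3)[OF fbT, of k] k by simp
    \<comment> \<open>When row \<open>k + 1\<close> is row \<open>i\<close>, the board gives
      \<open>k \<le> ?m\<close>, and \<open>k \<noteq> ?m\<close> makes this strict.\<close>
    moreover have "k < leftmost T (k + 1)"
      using left'[of "k + 1"] m k i by (cases "k + 1 = i") auto
    moreover have "leftmost T x \<noteq> k" if "1 \<le> x" "x < k + 1" for x
      using left'[of x] that k by (cases "x = i") auto
    ultimately show False using no_lower_top[of k "k + 1"] k by blast
  qed
  \<comment> \<open>The top of column \<open>?m\<close> lies strictly above the left-arrow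
    \<open>(i, ?m)\<close>. It could otherwise be lowered to row \<open>i - 1\<close>, the last row
    that keeps this support.\<close>
  have topm: "topmost T ?m = i - 1"
  proof (rule ccontr)
    assume neq: "topmost T ?m \<noteq> i - 1"
    have lt: "topmost T ?m < i - 1" using neq topmost_leftmost_less[OF fbT i(1,2)] by simp
    have "?m < leftmost T (i - 1)" using left'[of "i - 1"] i by simp
    moreover have "leftmost T x \<noteq> ?m" if "1 \<le> x" "x < i - 1" for x
      using left'[of x] that i by simp
    moreover have "i - 1 \<le> ?m + 1" "1 \<le> ?m" using m i by auto
    ultimately show False using no_lower_top[of ?m "i - 1"] lt i(3) by blast
  qed
  have a: "1 \<le> i - 1" "i - 1 \<le> ?m" using m i by auto
  show ?thesis
    using topmost_green[OF a i(3)] leftmost_green[OF a i(3)] dots_green[OF a i(3)]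
      top topm left dots i
    by (intro fb_tableau_eqI[OF fbT fb_tableau_green[OF a i(3)]]) auto
qed

lemma join_irreducible_blueI:
  assumes T: "T \<in> join_irreducibles (esTam n) (esTam_le n)"
    and left: "\<And>k. 2 \<le> k \<Longrightarrow> k \<le> n \<Longrightarrow> leftmost T k = n"
    and ij: "(i, j) \<in> dots T"
  shows "T = blue n (i - 1) j"
proof -
  obtain P where fbT: "fb_tableau n T" and P: "fb_tableau n P" and PT: "esTam_le n P T" "P \<noteq> T"
    and below: "\<And>S. fb_tableau n S \<Longrightarrow> esTam_le n S T \<Longrightarrow> S \<noteq> T \<Longrightarrow> esTam_le n S P"
    using T unfolding join_irreducible_esTam_iff by blast
  have left': "leftmost T k = n" if "1 \<le> k" "k \<le> n" for k
    using left[of k] leftmost_first[OF fbT] that by (cases "k = 1") auto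
  have d: "(i, j) \<in> T" "i \<le> j" "topmost T j < i" "j < leftmost T i"
    using ij by (auto simp: dots_iff)
  note b = fb_tableau_cell[OF fbT d(1)]
  have "j < n" using d(4) left' b by simp
  have "2 \<le> i" using d(3) topmost_bounds(1)[OF fbT b(3,4)] by simp
  let ?S = "T - {(i, j)}"
  note S = fb_tableau_remove_dot[OF fbT ij]
  note topS = topmost_remove_dot[OF fbT ij] and leftS = leftmost_remove_dot[OF fbT ij]
  have SP: "esTam_le n ?S P" using below[OF S remove_dot_le[OF fbT ij]] d(1) by blast
  \<comment> \<open>Deleting the dot leaves all coordinates of \<open>T\<close> unchanged, so if
    \<open>P\<close> contained this cell, \<open>T\<close> would lie below \<open>P\<close>.\<close>
  have notP: "(i, j) \<notin> P"
  proof
    assume mem: "(i, j) \<in> P"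
    have "esTam_le n T P" unfolding esTam_le_iff[OF fbT P]
    proof (intro conjI allI impI)
      show "topmost P k \<le> topmost T k" if "1 \<le> k \<and> k < n" for k
        using esTam_leD(1)[OF S P SP, of k] topS[of k] that by simp
      show "leftmost P k \<le> leftmost T k" if "2 \<le> k \<and> k \<le> n" for k
        using esTam_leD(2)[OF S P SP, of k] leftS[of k] that by simp
      fix x y assume xy: "(x, y) \<in> dots T \<and> y < leftmost P x"
      show "(x, y) \<in> P"
      proof (cases "(x, y) = (i, j)")
        case False
        have "(x, y) \<in> T" using xy by (simp add: dots_iff)
        then have "(x, y) \<in> dots ?S"
          using xy False fb_tableau_cell[OF fbT] topS leftS by (simp add: dots_iff)
        then show ?thesis using esTam_leD(3)[OF S P SP] xy by simp
      qed (use mem in simp)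
    qed
    then show False using esTam_le_antisym[OF P fbT PT(1)] PT(2) by simp
  qed
  \<comment> \<open>A dot of \<open>S\<close> at this cell would have to occur in \<open>P\<close>,
    whose row \<open>i\<close> still extends to the left of column \<open>j\<close>. So every
    tableau strictly below \<open>T\<close> loses this particular dot.\<close>
  have key: "(i, j) \<notin> dots S" if "fb_tableau n S" "esTam_le n S T" "S \<noteq> T" for S
    using esTam_leD(3)[OF that(1) P below[OF that], of i j] notP
      esTam_leD(2)[OF P fbT PT(1) \<open>2 \<le> i\<close> b(2)] d(4) by auto
  have dots: "dots T = {(i, j)}"
  proof (intro equalityI subrelI)
    fix x y assume xy: "(x, y) \<in> dots T"
    then have mem: "(x, y) \<in> T" by (simp add: dots_iff)
    have "(i, j) \<notin> dots (T - {(x, y)})"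
      using key[OF fb_tableau_remove_dot[OF fbT xy] remove_dot_le[OF fbT xy]] mem by blast
    then show "(x, y) \<in> {(i, j)}"
      using d topmost_remove_dot[OF fbT xy b(3,4)] leftmost_remove_dot[OF fbT xy b(1,2)]
      by (auto simp: dots_iff)
  qed (use ij in blast)
  \<comment> \<open>All rows reach column \<open>n\<close>, so any column top can be lowered as far
    as its border cell. By \<open>key\<close> such a move must destroy the dot, hence it must bring
    the top of column \<open>j\<close> down to row \<open>i\<close> or further.\<close>
  have no_lower_top: "k = j \<and> i \<le> a" if k: "1 \<le> k" "k < n" "topmost T k < a" "a \<le> k + 1" for k a
  proof (rule ccontr)
    assume neq: "\<not> (k = j \<and> i \<le> a)"
    have "1 \<le> a" "a \<le> n" using k topmost_bounds(1)[OF fbT, of k] by auto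
    then have l: "k < leftmost T a" "\<And>x. 1 \<le> x \<Longrightarrow> x < a \<Longrightarrow> leftmost T x \<noteq> k"
      using left' k by auto
    have "(i, j) \<notin> dots (lower_top a k T)"
      using key[OF fb_tableau_lower_top[OF fbT k l] lower_top_le[OF fbT k l]
          lower_top_neq[OF fbT k(1-3)]] .
    then show False
      using topmost_lower_top[OF fbT k l b(3,4)] leftmost_lower_top[OF fbT k l b(1,2)] d neq
      by (auto simp: dots_iff mem_lower_top_iff split: if_splits)
  qed
  have top: "topmost T k = k + 1" if k: "1 \<le> k" "k < n" "k \<noteq> j" for k
    using no_lower_top[of k "k + 1"] topmost_bounds(3)[OF fbT, of k] k by force
  have topj: "topmost T j = i - 1"
    using no_lower_top[of j "i - 1"] d b \<open>j < n\<close> by force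
  have a: "1 \<le> i - 1" "i - 1 < j" using \<open>2 \<le> i\<close> d(2) by auto
  show ?thesis
    using topmost_blue[OF a \<open>j < n\<close>] leftmost_blue[OF a \<open>j < n\<close>] dots_blue[OF a \<open>j < n\<close>]
      top topj left dots \<open>2 \<le> i\<close>
    by (intro fb_tableau_eqI[OF fbT fb_tableau_blue[OF a \<open>j < n\<close>]]) auto
qed

lemma join_irreducible_redE:
  assumes T: "T \<in> join_irreducibles (esTam n) (esTam_le n)"
    and left: "\<And>k. 2 \<le> k \<Longrightarrow> k \<le> n \<Longrightarrow> leftmost T k = n"
    and dots: "dots T = {}"
  obtains a j where "1 \<le> a" "a \<le> j" "j < n" "T = red n a j"
proof -
  obtain P where fbT: "fb_tableau n T" and P: "fb_tableau n P" and PT: "esTam_le n P T" "P \<noteq> T"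
    and below: "\<And>S. fb_tableau n S \<Longrightarrow> esTam_le n S T \<Longrightarrow> S \<noteq> T \<Longrightarrow> esTam_le n S P"
    using T unfolding join_irreducible_esTam_iff by blast
  have left': "leftmost T k = n" if "1 \<le> k" "k \<le> n" for k
    using left[of k] leftmost_first[OF fbT] that by (cases "k = 1") auto
  \<comment> \<open>With all rows reaching column \<open>n\<close> and no dots, \<open>T\<close> and
    \<open>P\<close> can be separated only by a column top. A column \<open>j\<close> where they
    differ is lowered in every tableau strictly below \<open>T\<close>, so no other column of
    \<open>T\<close> can be lowered on its own.\<close>
  have not_top_le: "\<not> (\<forall>k. 1 \<le> k \<and> k < n \<longrightarrow> topmost P k \<le> topmost T k)"
  proof
    assume "\<forall>k. 1 \<le> k \<and> k < n \<longrightarrow> topmost P k \<le> topmost T k"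
    then have "esTam_le n T P"
      unfolding esTam_le_iff[OF fbT P] using left leftmost_bounds(2)[OF P] dots by simp
    then show False using esTam_le_antisym[OF P fbT PT(1)] PT(2) by simp
  qed
  then obtain j where j: "1 \<le> j" "j < n" "topmost T j < topmost P j" by (auto simp: not_le)
  then have "topmost T j < j + 1" using topmost_bounds(3)[OF P, of j] by simp
  have key: "topmost T j < topmost S j" if "fb_tableau n S" "esTam_le n S T" "S \<noteq> T" for S
    using esTam_leD(1)[OF that(1) P below[OF that] j(1,2)] j(3) by simp
  have top: "topmost T k = k + 1" if k: "1 \<le> k" "k < n" "k \<noteq> j" for k
  proof (rule ccontr)
    assume "topmost T k \<noteq> k + 1"
    then have lt: "topmost T k < k + 1" using topmost_bounds(3)[OF fbT, of k] k by simp
    have l: "k + 1 \<le> k + 1" "k < leftmost T (k + 1)"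
      "\<And>x. 1 \<le> x \<Longrightarrow> x < k + 1 \<Longrightarrow> leftmost T x \<noteq> k"
      using left' k by auto
    show False
      using key[OF fb_tableau_lower_top[OF fbT k(1,2) lt l] lower_top_le[OF fbT k(1,2) lt l]
          lower_top_neq[OF fbT k(1,2) lt]] topmost_lower_top[OF fbT k(1,2) lt l, of j] j k
      by simp
  qed
  let ?a = "topmost T j"
  have a: "1 \<le> ?a" "?a \<le> j + 1" "?a \<le> j"
    using topmost_bounds[OF fbT, of j] j \<open>?a < j + 1\<close> by auto
  have "T = red n ?a j"
    using topmost_red[OF j(1,2) a(1,2)] leftmost_red[OF j(1,2) a(1,2)]
      dots_red[OF j(1,2) a(1,2)] top left dots
    by (intro fb_tableau_eqI[OF fbT fb_tableau_red[OF j(1,2) a(1,2)]]) auto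
  then show thesis using that a(1,3) j(2) by blast
qed

section \<open>The bijection with colored intervals\<close>

fun tableau_of :: "nat \<Rightarrow> colored_interval \<Rightarrow> filling" where
  "tableau_of n (Colored_Interval i j Red) = red n i j"
| "tableau_of n (Colored_Interval i j Green) = green n i j"
| "tableau_of n (Colored_Interval i j Blue) = blue n i j"

lemma Colored_Interval_mem_iff:
  "Colored_Interval i j Red \<in> colored_intervals n \<longleftrightarrow> 1 \<le> i \<and> i \<le> j \<and> j < n"
  "Colored_Interval i j Green \<in> colored_intervals n \<longleftrightarrow> 1 \<le> i \<and> i \<le> j \<and> j < n"
  "Colored_Interval i j Blue \<in> colored_intervals n \<longleftrightarrow> 1 \<le> i \<and> i < j \<and> j < n"
  by (auto simp: colored_intervals_def)

lemma tableau_of_join_irreducible: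
  assumes "c \<in> colored_intervals n"
  shows "tableau_of n c \<in> join_irreducibles (esTam n) (esTam_le n)"
proof -
  obtain i j col where c: "c = Colored_Interval i j col" by (cases c)
  show ?thesis
    using assms unfolding c
    by (cases col) (auto simp: Colored_Interval_mem_iff intro: red_join_irreducible
        green_join_irreducible blue_join_irreducible)
qed

lemma topmost_tableau_of:
  assumes "Colored_Interval i j col \<in> colored_intervals n" "1 \<le> k" "k < n"
  shows "topmost (tableau_of n (Colored_Interval i j col)) k = (if k = j then i else k + 1)"
  using assms
  by (cases col) (simp_all add: Colored_Interval_mem_iff topmost_red topmost_green topmost_blue)

text \<open>These two tests tell the colors apart: only green tableaux have a row not reaching
  column \<open>n\<close>, and only blue ones have a dot off the border.\<close>

lemma color_tableau_of:
  assumes "Colored_Interval i j col \<in> colored_intervals n"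
  shows "col = Green \<longleftrightarrow> leftmost (tableau_of n (Colored_Interval i j col)) (i + 1) < n"
    and "col = Blue \<longleftrightarrow> dots (tableau_of n (Colored_Interval i j col)) \<noteq> {}"
  using assms
  by (cases col; simp add: Colored_Interval_mem_iff leftmost_red leftmost_green leftmost_blue
      dots_red dots_green dots_blue)+

lemma inj_on_tableau_of: "inj_on (tableau_of n) (colored_intervals n)"
proof (rule inj_onI)
  fix c d
  assume c: "c \<in> colored_intervals n" and d: "d \<in> colored_intervals n"
    and eq: "tableau_of n c = tableau_of n d"
  obtain i j col where cc: "c = Colored_Interval i j col" by (cases c)
  obtain k l col' where dd: "d = Colored_Interval k l col'" by (cases d)
  have j: "i \<le> j" "1 \<le> j" "j < n"
    using c unfolding cc by (cases col; auto simp: Colored_Interval_mem_iff)+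
  \<comment> \<open>Both tableaux are evaluated in column \<open>j\<close>. As
    \<open>i \<le> j\<close>, the value is not \<open>j + 1\<close>, which forces
    \<open>l = j\<close> and then \<open>k = i\<close>.\<close>
  have "(if j = j then i else j + 1) = (if j = l then k else j + 1)"
    using topmost_tableau_of[of i j col n j] topmost_tableau_of[of k l col' n j] c d eq j
    unfolding cc dd by simp
  then have kl: "k = i" "l = j" using j by (auto split: if_splits)
  have "col = Green \<longleftrightarrow> col' = Green" "col = Blue \<longleftrightarrow> col' = Blue"
    using color_tableau_of[of i j col n] color_tableau_of[of k l col' n] c d eq
    unfolding cc dd kl by simp_all
  then have "col = col'" by (cases col; cases col'; simp)
  then show "c = d" unfolding cc dd kl by simp
qed

text \<open>The color is read off in order: green if some row stops short of column
  \<open>n\<close>, otherwise blue if there is a dot, otherwise red.\<close>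

lemma join_irreducible_tableau_of:
  assumes T: "T \<in> join_irreducibles (esTam n) (esTam_le n)"
  shows "T \<in> tableau_of n ` colored_intervals n"
proof -
  have fbT: "fb_tableau n T" using T unfolding join_irreducible_esTam_iff by blast
  consider i where "2 \<le> i" "i \<le> n" "leftmost T i < n"
    | i j where "\<And>k. 2 \<le> k \<Longrightarrow> k \<le> n \<Longrightarrow> leftmost T k = n" "(i, j) \<in> dots T"
    | "\<And>k. 2 \<le> k \<Longrightarrow> k \<le> n \<Longrightarrow> leftmost T k = n" "dots T = {}"
    using leftmost_bounds(2)[OF fbT]
    by (metis One_nat_def Suc_1 Suc_leD equals0I le_neq_implies_less surj_pair)
  then show ?thesis
  proof cases
    case (1 i)
    have "Colored_Interval (i - 1) (leftmost T i) Green \<in> colored_intervals n"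
      using 1 leftmost_bounds(3)[OF fbT, of i] unfolding Colored_Interval_mem_iff by linarith
    then show ?thesis
      using join_irreducible_greenI[OF T 1] by (intro image_eqI) auto
  next
    case (2 i j)
    then have d: "(i, j) \<in> T" "i \<le> j" "topmost T j < i" "j < leftmost T i"
      by (auto simp: dots_iff)
    note b = fb_tableau_cell[OF fbT d(1)]
    have "Colored_Interval (i - 1) j Blue \<in> colored_intervals n"
      using d topmost_bounds(1)[OF fbT b(3,4)] leftmost_bounds(2)[OF fbT b(1,2)]
      unfolding Colored_Interval_mem_iff by linarith
    then show ?thesis
      using join_irreducible_blueI[OF T 2] by (intro image_eqI) auto
  next
    case 3
    obtain a j where "1 \<le> a" "a \<le> j" "j < n" "T = red n a j"
      using join_irreducible_redE[OF T 3] by blast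
    then show ?thesis
      by (intro image_eqI[of _ _ "Colored_Interval a j Red"]) (auto simp: Colored_Interval_mem_iff)
  qed
qed

theorem proposition1p3:
  fixes n :: nat
  assumes "n \<ge> 1"
  shows "\<exists>f. bij_betw f (join_irreducibles (esTam n) (esTam_le n)) (colored_intervals n)"
proof -
  have "tableau_of n ` colored_intervals n = join_irreducibles (esTam n) (esTam_le n)"
    using tableau_of_join_irreducible join_irreducible_tableau_of by blast
  then have "bij_betw (tableau_of n) (colored_intervals n) (join_irreducibles (esTam n) (esTam_le n))"
    using inj_on_tableau_of by (simp add: bij_betw_def)
  then show ?thesis using bij_betw_inv_into by blast
qed

end
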